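(* Let $K$ be a field of characteristic zero, and let $\Delta$ be a finite subset of $K$. Suppose that $f:\mathbb{N}^d\to \Delta$ with $d\geq 1$ is such that $$F(x_1,\ldots ,x_d):=\sum_{(n_1,\ldots ,n_d)\in \mathbb{N}^d} f(n_1,\ldots ,n_d)x_1^{n_1}\cdots x_d^{n_d} \in K[[x_1,\ldots ,x_d]]$$ is D-finite. Then $F$ is rational, i.e. $F = P/Q$ in $K((x_1,\ldots,x_d))$ for some polynomials $P,Q\in K[x_1,\ldots,x_d]$ with $Q\neq 0$.
   Context: $\mathbb{N}$ denotes the set of nonnegative integers. $K((x_1,\ldots,x_d))$ denotes the field of fractions of $K[[x_1,\ldots,x_d]]$, and $D_{x_i}$ denotes the derivation $\partial/\partial x_i$ on it. A power series $F\in K[[x_1,\ldots,x_d]]$ is D-finite (over $K(x_1,\ldots,x_d)$) if the set of all derivatives $D_{x_1}^{i_1}\cdots D_{x_d}^{i_d}(F)$, $i_j\in\mathbb{N}$, spans a finite-dimensional $K(x_1,\ldots,x_d)$-vector subspace of $K((x_1,\ldots,x_d))$; equivalently, for each $i\in\{1,\ldots,d\}$, $F$ satisfies a nontrivial linear differential equation $\sum_{j=0}^{m_i} p_{i,j} D_{x_i}^j F = 0$ with $p_{i,j}\in K[x_1,\ldots,x_d]$. *)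

theory Defs
  imports
    "HOL-Analysis.Finite_Cartesian_Product"
    "HOL-Library.Poly_Mapping"
    "HOL-Computational_Algebra.Polynomial_Factorial"
begin

section \<open>Formal power series in several variables\<close>

text \<open>
  The variables are indexed by a finite type \<open>'n\<close> with \<open>d = CARD('n)\<close> elements, so that
  exponent vectors are elements of \<open>nat ^ 'n\<close>.
\<close>

typedef ('a, 'n) mfps = "UNIV :: (nat ^ 'n \<Rightarrow> 'a) set"
  morphisms mfps_coeff Abs_mfps
  by simp

setup_lifting type_definition_mfps

lemma mfps_coeff_Abs [simp]: "mfps_coeff (Abs_mfps f) n = f n"
  by (simp add: Abs_mfps_inverse)

lemma mfps_ext: "(\<And>n. mfps_coeff F n = mfps_coeff G n) \<Longrightarrow> F = G"
  by (simp add: mfps_coeff_inject [symmetric] fun_eq_iff)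

lemma finite_vec_le: "finite {m :: nat ^ 'n. m \<le> n}"
proof (rule finite_subset)
  show "{m. m \<le> n} \<subseteq> vec_lambda ` (\<Pi>\<^sub>E i\<in>UNIV. {..n $ i})"
  proof
    fix m assume "m \<in> {m. m \<le> n}"
    then have "m = vec_lambda (\<lambda>i. m $ i)" "(\<lambda>i. m $ i) \<in> (\<Pi>\<^sub>E i\<in>UNIV. {..n $ i})"
      by (auto simp: less_eq_vec_def)
    then show "m \<in> vec_lambda ` (\<Pi>\<^sub>E i\<in>UNIV. {..n $ i})" by blast
  qed
  show "finite (vec_lambda ` (\<Pi>\<^sub>E i\<in>(UNIV::'n set). {..n $ i}))"
    by (intro finite_imageI finite_PiE) auto
qed

lemma finite_vec_antidiag [simp, intro]: "finite {(i, j). i + j = (n :: nat ^ 'n)}"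
proof (rule finite_subset)
  show "{(i, j). i + j = n} \<subseteq> {m. m \<le> n} \<times> {m. m \<le> n}"
    by (auto simp: less_eq_vec_def)
qed (simp add: finite_vec_le)

instantiation mfps :: (comm_ring_1, finite) comm_ring_1
begin

lift_definition zero_mfps :: "('a, 'b) mfps" is "\<lambda>_. 0" .
lift_definition one_mfps :: "('a, 'b) mfps" is "\<lambda>n. if n = 0 then 1 else 0" .
lift_definition plus_mfps :: "('a, 'b) mfps \<Rightarrow> ('a, 'b) mfps \<Rightarrow> ('a, 'b) mfps"
  is "\<lambda>F G n. F n + G n" .
lift_definition minus_mfps :: "('a, 'b) mfps \<Rightarrow> ('a, 'b) mfps \<Rightarrow> ('a, 'b) mfps"
  is "\<lambda>F G n. F n - G n" .
lift_definition uminus_mfps :: "('a, 'b) mfps \<Rightarrow> ('a, 'b) mfps"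
  is "\<lambda>F n. - F n" .
lift_definition times_mfps :: "('a, 'b) mfps \<Rightarrow> ('a, 'b) mfps \<Rightarrow> ('a, 'b) mfps"
  is "\<lambda>F G n. \<Sum>(i, j) \<in> {(i, j). i + j = n}. F i * G j" .

instance
proof
  fix F G H :: "('a, 'b) mfps"
  show "F * G * H = F * (G * H)"
  proof (transfer, rule ext)
    fix F G H :: "nat ^ 'b \<Rightarrow> 'a" and n
    have "(\<Sum>(m, k) \<in> {(m, k). m + k = n}. (\<Sum>(i, j) \<in> {(i, j). i + j = m}. F i * G j) * H k)
        = (\<Sum>(x, y) \<in> Sigma {(m, k). m + k = n} (\<lambda>(m, k). {(i, j). i + j = m}).
             F (fst y) * G (snd y) * H (snd x))"
      by (subst sum.Sigma [symmetric]) (auto simp: sum_distrib_right case_prod_beta)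
    also have "\<dots> = (\<Sum>(x, y) \<in> Sigma {(i, m). i + m = n} (\<lambda>(i, m). {(j, k). j + k = m}).
             F (fst x) * (G (fst y) * H (snd y)))"
      by (rule sum.reindex_bij_witness
            [where i = "\<lambda>((i, m), (j, k)). ((i + j, k), (i, j))"
               and j = "\<lambda>((m, k), (i, j)). ((i, j + k), (j, k))"])
         (auto simp: algebra_simps)
    also have "\<dots> = (\<Sum>(i, m) \<in> {(i, m). i + m = n}.
                       F i * (\<Sum>(j, k) \<in> {(j, k). j + k = m}. G j * H k))"
      by (subst sum.Sigma [symmetric]) (auto simp: sum_distrib_left case_prod_beta)
    finally show "(\<Sum>(m, k) \<in> {(m, k). m + k = n}. (\<Sum>(i, j) \<in> {(i, j). i + j = m}. F i * G j) * H k)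
      = (\<Sum>(i, m) \<in> {(i, m). i + m = n}. F i * (\<Sum>(j, k) \<in> {(j, k). j + k = m}. G j * H k))" .
  qed
  show "F * G = G * F"
    by (transfer, rule ext,
        rule sum.reindex_bij_witness [where i = "\<lambda>(i, j). (j, i)" and j = "\<lambda>(i, j). (j, i)"])
       (auto simp: add.commute mult.commute)
  show "1 * F = F"
  proof (transfer, rule ext)
    fix F :: "nat ^ 'b \<Rightarrow> 'a" and n
    have "(\<Sum>(i, j) \<in> {(i, j). i + j = n}. (if i = 0 then 1 else 0) * F j)
        = (\<Sum>(i, j) \<in> {(0 :: nat ^ 'b, n)}. (if i = 0 then 1 else 0) * F j)"
      by (rule sum.mono_neutral_right [OF finite_vec_antidiag]) (auto split: if_splits)
    then show "(\<Sum>(i, j) \<in> {(i, j). i + j = n}. (if i = 0 then 1 else 0) * F j) = F n"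
      by simp
  qed
  show "(F + G) * H = F * H + G * H"
    by (transfer, rule ext) (simp add: case_prod_beta distrib_right sum.distrib)
  show "(0 :: ('a, 'b) mfps) \<noteq> 1"
    by transfer (metis zero_neq_one)
qed (transfer, simp add: algebra_simps fun_eq_iff)+

end

lemma mfps_coeff_mult:
  "mfps_coeff (F * G) n = (\<Sum>(i, j) \<in> {(i, j). i + j = n}. mfps_coeff F i * mfps_coeff G j)"
  by (simp add: times_mfps.rep_eq)

text \<open>An additive injection of exponent vectors into a linearly ordered monoid (a monomial order).\<close>

lemma ex_additive_embedding:
  "\<exists>e :: nat ^ 'n \<Rightarrow> nat \<Rightarrow>\<^sub>0 nat. inj e \<and> (\<forall>m n. e (m + n) = e m + e n)"
proof -
  obtain g :: "'n \<Rightarrow> nat" where g: "inj g"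
    using finite_imp_inj_to_nat_seg [of "UNIV :: 'n set"] by auto
  define e where "e = (\<lambda>m :: nat ^ 'n. \<Sum>i\<in>UNIV. Poly_Mapping.single (g i) (m $ i))"
  have "Poly_Mapping.lookup (e m) (g i) = m $ i" for m i
    by (simp add: e_def lookup_sum lookup_single when_def inj_eq [OF g])
  then have "inj e"
    by (metis injI vec_eq_iff)
  moreover have "e (m + n) = e m + e n" for m n
    by (simp add: e_def single_add sum.distrib)
  ultimately show ?thesis by blast
qed

lemma mfps_ex_initial:
  fixes F :: "('a :: zero, 'n :: finite) mfps" and e :: "nat ^ 'n \<Rightarrow> 'b :: linorder"
  assumes "\<exists>n. mfps_coeff F n \<noteq> 0" and "inj e"
  obtains a where "mfps_coeff F a \<noteq> 0"
    and "\<And>m. mfps_coeff F m \<noteq> 0 \<Longrightarrow> sum (($) a) UNIV \<le> sum (($) m) UNIV"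
    and "\<And>m. mfps_coeff F m \<noteq> 0 \<Longrightarrow> sum (($) m) UNIV = sum (($) a) UNIV \<Longrightarrow> e a \<le> e m"
proof -
  let ?deg = "\<lambda>m :: nat ^ 'n. sum (($) m) UNIV"
  obtain b where b: "mfps_coeff F b \<noteq> 0" "\<And>m. mfps_coeff F m \<noteq> 0 \<Longrightarrow> ?deg b \<le> ?deg m"
    using ex_has_least_nat [of "\<lambda>m. mfps_coeff F m \<noteq> 0" _ ?deg] assms(1) by metis
  define S where "S = {m. mfps_coeff F m \<noteq> 0 \<and> ?deg m = ?deg b}"
  have "S \<subseteq> {m. m \<le> (\<chi> i. ?deg b)}"
  proof
    fix m assume m: "m \<in> S"
    have "m $ i \<le> ?deg m" for i by (rule member_le_sum) auto
    then show "m \<in> {m. m \<le> (\<chi> i. ?deg b)}"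
      using m by (auto simp: S_def less_eq_vec_def)
  qed
  then have fin: "finite S" using finite_vec_le finite_subset by blast
  have "b \<in> S" using b by (simp add: S_def)
  then obtain a where a: "a \<in> S" "\<And>m. m \<in> S \<Longrightarrow> e a \<le> e m"
    using ex_min_if_finite [of "e ` S"] fin by (metis (no_types, lifting) empty_iff
      finite_imageI image_eqI imageE not_less)
  show thesis
    using that [of a] a b by (auto simp: S_def)
qed

instance mfps :: (idom, finite) idom
proof
  fix F G :: "('a, 'b) mfps"
  assume "F \<noteq> 0" "G \<noteq> 0"
  then have F: "\<exists>n. mfps_coeff F n \<noteq> 0" and G: "\<exists>n. mfps_coeff G n \<noteq> 0"
    using mfps_ext [of F 0] mfps_ext [of G 0] by (auto simp: zero_mfps.rep_eq)
  obtain e :: "nat ^ 'b \<Rightarrow> nat \<Rightarrow>\<^sub>0 nat"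
    where e: "inj e" and e_add: "\<And>m n. e (m + n) = e m + e n"
    using ex_additive_embedding by blast
  let ?deg = "\<lambda>m :: nat ^ 'b. sum (($) m) UNIV"
  have deg_add: "?deg (m + n) = ?deg m + ?deg n" for m n
    by (simp add: sum.distrib)
  obtain a where a: "mfps_coeff F a \<noteq> 0"
    "\<And>m. mfps_coeff F m \<noteq> 0 \<Longrightarrow> ?deg a \<le> ?deg m"
    "\<And>m. mfps_coeff F m \<noteq> 0 \<Longrightarrow> ?deg m = ?deg a \<Longrightarrow> e a \<le> e m"
    using mfps_ex_initial [OF F e] by blast
  obtain b where b: "mfps_coeff G b \<noteq> 0"
    "\<And>m. mfps_coeff G m \<noteq> 0 \<Longrightarrow> ?deg b \<le> ?deg m"
    "\<And>m. mfps_coeff G m \<noteq> 0 \<Longrightarrow> ?deg m = ?deg b \<Longrightarrow> e b \<le> e m"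
    using mfps_ex_initial [OF G e] by blast
  have uniq: "i = a \<and> j = b"
    if "i + j = a + b" "mfps_coeff F i \<noteq> 0" "mfps_coeff G j \<noteq> 0" for i j
  proof -
    have "?deg i + ?deg j = ?deg a + ?deg b" using that(1) deg_add by metis
    with a(2) [OF that(2)] b(2) [OF that(3)]
    have "?deg i = ?deg a" "?deg j = ?deg b" by linarith+
    then have le: "e a \<le> e i" "e b \<le> e j" using a(3) b(3) that by auto
    have "e i + e j = e a + e b" using that(1) e_add by metis
    with le have "e i = e a"
      by (metis add_le_cancel_left add_mono_thms_linordered_semiring(3) add_right_cancel
          antisym order_refl)
    then have "i = a" using e by (simp add: inj_eq)
    with that(1) show ?thesis by simp
  qed
  have "mfps_coeff (F * G) (a + b) = (\<Sum>(i, j) \<in> {(a, b)}. mfps_coeff F i * mfps_coeff G j)"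
    unfolding mfps_coeff_mult
    by (rule sum.mono_neutral_right [OF finite_vec_antidiag]) (use uniq in fastforce)+
  also have "\<dots> \<noteq> 0" using a(1) b(1) by simp
  finally show "F * G \<noteq> 0" by (metis zero_mfps.rep_eq)
qed


section \<open>Partial derivatives\<close>

definition mfps_deriv :: "'n \<Rightarrow> ('a :: comm_ring_1, 'n :: finite) mfps \<Rightarrow> ('a, 'n) mfps" where
  "mfps_deriv i F = Abs_mfps (\<lambda>n. of_nat (n $ i + 1) * mfps_coeff F (n + axis i 1))"

text \<open>
  The mixed partial derivative \<open>D\<^sub>1^k\<^sub>1 \<cdots> D\<^sub>d^k\<^sub>d F\<close>. The fold is independent of the
  order of the variables because the partial derivatives commute (next lemmas).
\<close>

definition mfps_mixed_deriv ::
  "nat ^ 'n \<Rightarrow> ('a :: comm_ring_1, 'n :: finite) mfps \<Rightarrow> ('a, 'n) mfps" where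
  "mfps_mixed_deriv k F = Finite_Set.fold (\<lambda>i. mfps_deriv i ^^ (k $ i)) F UNIV"

lemma mfps_deriv_commute: "mfps_deriv i (mfps_deriv j F) = mfps_deriv j (mfps_deriv i F)"
  by (rule mfps_ext) (auto simp: mfps_deriv_def axis_def add_ac mult_ac)

lemma mfps_deriv_funpow_commute:
  fixes i j :: "'n :: finite"
  shows "(mfps_deriv i ^^ m) \<circ> (mfps_deriv j ^^ n) =
    ((mfps_deriv j ^^ n) \<circ> (mfps_deriv i ^^ m) ::
      ('a :: comm_ring_1, 'n) mfps \<Rightarrow> ('a, 'n) mfps)"
proof
  fix F :: "('a, 'n) mfps"
  have "mfps_deriv i ((mfps_deriv j ^^ n) G) = (mfps_deriv j ^^ n) (mfps_deriv i G)"
    for G :: "('a, 'n) mfps"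
    by (induction n) (simp_all add: mfps_deriv_commute [of i j])
  then show "((mfps_deriv i ^^ m) \<circ> (mfps_deriv j ^^ n)) F =
      ((mfps_deriv j ^^ n) \<circ> (mfps_deriv i ^^ m)) F"
    by (induction m) simp_all
qed

lemma comp_fun_commute_mfps_deriv: "comp_fun_commute (\<lambda>i. mfps_deriv i ^^ (k $ i))"
  by unfold_locales (rule mfps_deriv_funpow_commute)


section \<open>Polynomials and rational functions\<close>

text \<open>
  The polynomial ring \<open>K[x\<^sub>1,\<dots>,x\<^sub>d]\<close> is \<open>(nat ^ 'n) \<Rightarrow>\<^sub>0 'a\<close>, and \<open>K((x\<^sub>1,\<dots>,x\<^sub>d))\<close> is
  \<open>('a, 'n) mfps fract\<close>.
\<close>

definition mfps_of_mpoly :: "((nat ^ 'n) \<Rightarrow>\<^sub>0 'a :: zero) \<Rightarrow> ('a, 'n :: finite) mfps" where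
  "mfps_of_mpoly P = Abs_mfps (Poly_Mapping.lookup P)"

lemma mfps_of_mpoly_0 [simp]: "mfps_of_mpoly (0 :: _ \<Rightarrow>\<^sub>0 'a :: comm_ring_1) = 0"
  by (rule mfps_ext) (simp add: mfps_of_mpoly_def zero_mfps.rep_eq)

lemma mfps_of_mpoly_1 [simp]: "mfps_of_mpoly (1 :: _ \<Rightarrow>\<^sub>0 'a :: comm_ring_1) = 1"
  by (rule mfps_ext) (simp add: mfps_of_mpoly_def one_mfps.rep_eq lookup_one when_def)

lemma mfps_of_mpoly_add [simp]:
  "mfps_of_mpoly (P + Q :: _ \<Rightarrow>\<^sub>0 'a :: comm_ring_1) = mfps_of_mpoly P + mfps_of_mpoly Q"
  by (rule mfps_ext) (simp add: mfps_of_mpoly_def plus_mfps.rep_eq lookup_add)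

lemma mfps_of_mpoly_uminus [simp]:
  "mfps_of_mpoly (- P :: _ \<Rightarrow>\<^sub>0 'a :: comm_ring_1) = - mfps_of_mpoly P"
  by (rule mfps_ext) (simp add: mfps_of_mpoly_def uminus_mfps.rep_eq)

lemma mfps_of_mpoly_mult [simp]:
  "mfps_of_mpoly (P * Q :: _ \<Rightarrow>\<^sub>0 'a :: comm_ring_1) = mfps_of_mpoly P * mfps_of_mpoly Q"
proof (rule mfps_ext)
  fix n
  let ?p = "Poly_Mapping.lookup P" and ?q = "Poly_Mapping.lookup Q"
  have "Poly_Mapping.lookup (P * Q) n = (\<Sum>(i, j). ?p i * ?q j when n = i + j)"
    unfolding times_poly_mapping.rep_eq
    by (rule prod_fun_unfold_prod) simp_all
  also have "\<dots> = (\<Sum>(i, j) \<in> {(i, j). i + j = n}. ?p i * ?q j when n = i + j)"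
    by (rule Sum_any.expand_superset) (auto split: if_splits)
  also have "\<dots> = (\<Sum>(i, j) \<in> {(i, j). i + j = n}. ?p i * ?q j)"
    by (rule sum.cong) auto
  finally show "mfps_coeff (mfps_of_mpoly (P * Q)) n = mfps_coeff (mfps_of_mpoly P * mfps_of_mpoly Q) n"
    by (simp add: mfps_of_mpoly_def mfps_coeff_mult)
qed

lemma mfps_of_mpoly_eq_0_iff [simp]:
  "mfps_of_mpoly (P :: _ \<Rightarrow>\<^sub>0 'a :: comm_ring_1) = 0 \<longleftrightarrow> P = 0"
proof
  assume "mfps_of_mpoly P = 0"
  then have "Poly_Mapping.lookup P n = 0" for n
    by (metis mfps_coeff_Abs mfps_of_mpoly_def zero_mfps.rep_eq)
  then show "P = 0" by (intro poly_mapping_eqI) simp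
qed simp

text \<open>The field \<open>K(x\<^sub>1,\<dots>,x\<^sub>d)\<close>, as a subfield of \<open>K((x\<^sub>1,\<dots>,x\<^sub>d))\<close>.\<close>

typedef (overloaded) ('a, 'n) ratfun =
  "{Fract (mfps_of_mpoly P) (mfps_of_mpoly Q) | P Q :: (nat ^ 'n :: finite) \<Rightarrow>\<^sub>0 'a :: field. Q \<noteq> 0}"
  morphisms fract_of_ratfun Abs_ratfun
  by (auto intro: exI [of _ 1])

setup_lifting type_definition_ratfun

lemma mfps_of_mpoly_mult_nonzero:
  fixes P Q :: "(nat ^ 'n :: finite) \<Rightarrow>\<^sub>0 'a :: idom"
  assumes "P \<noteq> 0" "Q \<noteq> 0"
  shows "P * Q \<noteq> 0"
proof -
  have "mfps_of_mpoly P * mfps_of_mpoly Q \<noteq> 0"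
    using assms by simp
  then show ?thesis by (metis mfps_of_mpoly_0 mfps_of_mpoly_mult)
qed

instantiation ratfun :: (field, finite) field
begin

lift_definition zero_ratfun :: "('a, 'b) ratfun" is 0
  by (rule exI [of _ 0], rule exI [of _ 1]) (simp add: fract_expand)

lift_definition one_ratfun :: "('a, 'b) ratfun" is 1
  by (rule exI [of _ 1], rule exI [of _ 1]) (simp add: fract_expand)

lift_definition plus_ratfun :: "('a, 'b) ratfun \<Rightarrow> ('a, 'b) ratfun \<Rightarrow> ('a, 'b) ratfun" is "(+)"
proof -
  fix r s :: "('a, 'b) mfps fract"
  assume "\<exists>P Q. r = Fract (mfps_of_mpoly P) (mfps_of_mpoly Q) \<and> Q \<noteq> 0"
    and "\<exists>P Q. s = Fract (mfps_of_mpoly P) (mfps_of_mpoly Q) \<and> Q \<noteq> 0"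
  then obtain P Q P' Q' where
    "r = Fract (mfps_of_mpoly P) (mfps_of_mpoly Q)" "Q \<noteq> 0"
    "s = Fract (mfps_of_mpoly P') (mfps_of_mpoly Q')" "Q' \<noteq> 0" by blast
  then have "r + s = Fract (mfps_of_mpoly (P * Q' + P' * Q)) (mfps_of_mpoly (Q * Q'))" "Q * Q' \<noteq> 0"
    by (simp_all add: mfps_of_mpoly_mult_nonzero)
  then show "\<exists>P Q. r + s = Fract (mfps_of_mpoly P) (mfps_of_mpoly Q) \<and> Q \<noteq> 0" by blast
qed

lift_definition uminus_ratfun :: "('a, 'b) ratfun \<Rightarrow> ('a, 'b) ratfun" is uminus
  by (metis minus_fract mfps_of_mpoly_uminus)

definition minus_ratfun :: "('a, 'b) ratfun \<Rightarrow> ('a, 'b) ratfun \<Rightarrow> ('a, 'b) ratfun" where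
  "minus_ratfun r s = r + - s"

lift_definition times_ratfun :: "('a, 'b) ratfun \<Rightarrow> ('a, 'b) ratfun \<Rightarrow> ('a, 'b) ratfun" is "(*)"
  by (metis mult_fract mfps_of_mpoly_mult mfps_of_mpoly_mult_nonzero)

lift_definition inverse_ratfun :: "('a, 'b) ratfun \<Rightarrow> ('a, 'b) ratfun" is inverse
proof -
  fix r :: "('a, 'b) mfps fract"
  assume "\<exists>P Q. r = Fract (mfps_of_mpoly P) (mfps_of_mpoly Q) \<and> Q \<noteq> 0"
  then obtain P Q where r: "r = Fract (mfps_of_mpoly P) (mfps_of_mpoly Q)" "Q \<noteq> 0" by blast
  show "\<exists>P Q. inverse r = Fract (mfps_of_mpoly P) (mfps_of_mpoly Q) \<and> Q \<noteq> 0"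
  proof (cases "P = 0")
    case True
    then have "inverse r = Fract (mfps_of_mpoly 0) (mfps_of_mpoly 1)"
      using r by (simp add: fract_collapse)
    then show ?thesis by (metis zero_neq_one)
  next
    case False
    then show ?thesis using r by auto
  qed
qed

definition divide_ratfun :: "('a, 'b) ratfun \<Rightarrow> ('a, 'b) ratfun \<Rightarrow> ('a, 'b) ratfun" where
  "divide_ratfun r s = r * inverse s"

instance
proof
  fix r s :: "('a, 'b) ratfun"
  show "r - s = r + - s" by (rule minus_ratfun_def)
  show "r div s = r * inverse s" by (rule divide_ratfun_def)
qed (transfer, simp add: algebra_simps)+

end

text \<open>\<open>K((x\<^sub>1,\<dots>,x\<^sub>d))\<close> as a vector space over \<open>K(x\<^sub>1,\<dots>,x\<^sub>d)\<close>.\<close>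

definition ratfun_scale ::
  "('a :: field, 'n :: finite) ratfun \<Rightarrow> ('a, 'n) mfps fract \<Rightarrow> ('a, 'n) mfps fract" where
  "ratfun_scale r v = fract_of_ratfun r * v"

global_interpretation ratfun: vector_space ratfun_scale
  by unfold_locales
     (simp_all add: ratfun_scale_def algebra_simps plus_ratfun.rep_eq times_ratfun.rep_eq
        one_ratfun.rep_eq)


section \<open>D-finiteness\<close>

definition D_finite :: "('a :: field, 'n :: finite) mfps \<Rightarrow> bool" where
  "D_finite F \<longleftrightarrow> (\<exists>B. finite B \<and>
     ratfun.span B = ratfun.span (range (\<lambda>k. to_fract (mfps_mixed_deriv k F))))"

end

theory Submission
  imports Defs
begin

text \<open>
  The operator \<open>x\<^sub>i^j D\<^sub>i^j\<close> multiplies the coefficient at \<open>n\<close> by a monic polynomial of degree \<open>j\<close>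
  in \<open>n\<^sub>i\<close>. A relation \<open>\<Sum>j\<le>m. q\<^sub>j x\<^sub>i^j D\<^sub>i^j F = 0\<close> therefore says that \<open>R\<^sub>n (n\<^sub>i) = 0\<close> for all
  \<open>n\<close>, where \<open>R\<^sub>n\<close> is a univariate polynomial that depends only on finitely many coefficients of
  \<open>F\<close> near \<open>n\<close>. As these lie in a finite set, only finitely many polynomials \<open>R\<^sub>n\<close> occur, hence
  \<open>R\<^sub>n = 0\<close> once \<open>n\<^sub>i\<close> is large. The coefficient of degree \<open>m\<close> of \<open>R\<^sub>n\<close> is the coefficient of
  \<open>q\<^sub>m F\<close> at \<open>n\<close>, so the support of \<open>q\<^sub>m F\<close> is bounded in direction \<open>i\<close>. Multiplying \<open>F\<close> by one such
  polynomial for every \<open>i\<close> yields a series with bounded support, that is, a polynomial.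
\<close>

section \<open>Products of polynomials, and of a polynomial with a series\<close>

lemma mpoly_prod_nonzero:
  fixes P :: "'i \<Rightarrow> (nat ^ 'n :: finite) \<Rightarrow>\<^sub>0 'a :: idom"
  assumes "\<And>i. i \<in> A \<Longrightarrow> P i \<noteq> 0"
  shows "(\<Prod>i\<in>A. P i) \<noteq> 0"
  using assms by (induction A rule: infinite_finite_induct) (auto dest: mfps_of_mpoly_mult_nonzero [rotated])

text \<open>Summing over \<open>keys P\<close>, which is the same for every \<open>n\<close>, shows
  that each coefficient of the product reads a window of fixed shape in \<open>F\<close>. The guard
  \<open>a \<le> n\<close> matters because subtraction of exponents truncates.\<close>

lemma mfps_coeff_mult_mpoly:
  fixes P :: "(nat ^ 'n :: finite) \<Rightarrow>\<^sub>0 'a :: comm_ring_1"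
  shows "mfps_coeff (mfps_of_mpoly P * F) n =
    (\<Sum>a\<in>Poly_Mapping.keys P. Poly_Mapping.lookup P a * (if a \<le> n then mfps_coeff F (n - a) else 0))"
proof -
  let ?p = "Poly_Mapping.lookup P"
  have diff: "a + (n - a) = n" if "a \<le> n" for a
    using that by (simp add: vec_eq_iff less_eq_vec_def)
  have "mfps_coeff (mfps_of_mpoly P * F) n =
      (\<Sum>(a, b) \<in> {(a, b). a + b = n}. ?p a * mfps_coeff F b)"
    by (simp add: mfps_coeff_mult mfps_of_mpoly_def)
  also have "\<dots> = (\<Sum>a | a \<le> n. ?p a * mfps_coeff F (n - a))"
    by (rule sum.reindex_bij_witness [where i = "\<lambda>a. (a, n - a)" and j = fst])
       (auto simp: diff less_eq_vec_def)
  also have "\<dots> = (\<Sum>a\<in>Poly_Mapping.keys P \<inter> {a. a \<le> n}. ?p a * mfps_coeff F (n - a))"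
    by (rule sum.mono_neutral_right) (auto simp: finite_vec_le in_keys_iff)
  also have "\<dots> = (\<Sum>a\<in>Poly_Mapping.keys P. ?p a * (if a \<le> n then mfps_coeff F (n - a) else 0))"
    by (rule sum.mono_neutral_cong_left) auto
  finally show ?thesis .
qed

subsection \<open>Iterated partial derivatives\<close>

text \<open>All exponents off \<open>i\<close> vanish, so the other folded operators are identities.
  This gives access to the pure derivatives in \<open>D_finite\<close>.\<close>

lemma mfps_mixed_deriv_axis: "mfps_mixed_deriv (axis i j) F = (mfps_deriv i ^^ j) F"
proof -
  let ?f = "\<lambda>l. mfps_deriv l ^^ (axis i j $ l)"
  interpret comp_fun_commute ?f
    by (rule comp_fun_commute_mfps_deriv)
  have "Finite_Set.fold ?f F A = F" if "finite A" "i \<notin> A" for A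
    using that
  proof (induction A rule: finite_induct)
    case (insert l A)
    then have "axis i j $ l = 0"
      by (auto simp: axis_def)
    with insert show ?case
      by (subst fold_insert) (auto simp del: axis_nth)
  qed simp
  then have "Finite_Set.fold ?f F (insert i (UNIV - {i})) = (mfps_deriv i ^^ j) F"
    by (subst fold_insert) auto
  then show ?thesis
    by (simp add: mfps_mixed_deriv_def insert_absorb)
qed

lemma mfps_coeff_deriv_funpow:
  fixes F :: "('a :: comm_ring_1, 'n :: finite) mfps"
  shows "mfps_coeff ((mfps_deriv i ^^ j) F) n =
    pochhammer (of_nat (n $ i) + 1) j * mfps_coeff F (n + axis i j)"
proof (induction j arbitrary: n)
  case 0
  have "n + axis i 0 = n"
    by (simp add: axis_def vec_eq_iff)
  then show ?case by (simp only: funpow_0 pochhammer_0 mult_1_left)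
next
  case (Suc j)
  have shift: "n + axis i 1 + axis i j = n + axis i (Suc j)"
    by (simp add: vec_eq_iff axis_def)
  have "mfps_coeff ((mfps_deriv i ^^ Suc j) F) n =
      of_nat (n $ i + 1) * mfps_coeff ((mfps_deriv i ^^ j) F) (n + axis i 1)"
    by (simp add: mfps_deriv_def)
  also have "\<dots> = (of_nat (n $ i) + 1) * pochhammer (of_nat (n $ i) + 1 + 1) j *
      mfps_coeff F (n + axis i (Suc j))"
    unfolding Suc shift by (simp add: add_ac mult.assoc)
  finally show ?case
    by (simp only: pochhammer_rec)
qed

definition mfps_euler :: "'n \<Rightarrow> nat \<Rightarrow> ('a :: comm_ring_1, 'n :: finite) mfps \<Rightarrow> ('a, 'n) mfps" where
  "mfps_euler i j F = mfps_of_mpoly (Poly_Mapping.single (axis i j) 1) * (mfps_deriv i ^^ j) F"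

text \<open>The factor is the falling factorial of n_i of length \<open>j\<close>, read upwards from
  its smallest factor. Differences are taken in the field, without truncation.\<close>

lemma mfps_coeff_euler:
  fixes F :: "('a :: field_char_0, 'n :: finite) mfps"
  shows "mfps_coeff (mfps_euler i j F) n = pochhammer (of_nat (n $ i) - of_nat j + 1) j * mfps_coeff F n"
proof (cases "axis i j \<le> n")
  case True
  then have "n - axis i j + axis i j = n"
    by (simp add: vec_eq_iff less_eq_vec_def)
  moreover have "j \<le> n $ i"
    using True by (auto simp: less_eq_vec_def axis_def split: if_splits)
  ultimately show ?thesis
    using True by (simp add: mfps_euler_def mfps_coeff_mult_mpoly mfps_coeff_deriv_funpow of_nat_diff)
next
  case False
  then have less: "n $ i < j"
    by (auto simp: less_eq_vec_def axis_def not_le split: if_splits)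
  \<comment> \<open>The rising product starts at a nonpositive integer of absolute value less than
    \<open>j\<close>, so 0 is among its factors.\<close>
  have eq: "of_nat (n $ i) - of_nat j + 1 = (- of_nat (j - 1 - n $ i) :: 'a)"
    using less by (simp add: of_nat_diff)
  have "pochhammer (of_nat (n $ i) - of_nat j + 1 :: 'a) j = 0"
    unfolding eq by (rule pochhammer_of_nat_eq_0_lemma) (use less in auto)
  then show ?thesis
    using False by (simp add: mfps_euler_def mfps_coeff_mult_mpoly)
qed

subsection \<open>Polynomial relations from finite dimension\<close>

text \<open>If \<open>v\<close> is injective, its infinite image is too large to be independent in
  the span of a finite set. Otherwise two equal members cancel.\<close>

lemma (in vector_space) infinite_family_dependent:
  assumes "finite B" and "infinite I" and "\<And>j. j \<in> I \<Longrightarrow> v j \<in> span B"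
  shows "\<exists>J u. finite J \<and> J \<subseteq> I \<and> (\<exists>j\<in>J. u j \<noteq> 0) \<and> (\<Sum>j\<in>J. scale (u j) (v j)) = 0"
proof (cases "inj_on v I")
  case True
  have "dependent (v ` I)"
    using independent_span_bound [OF assms(1), of "v ` I"] assms True by (auto simp: finite_image_iff)
  then obtain S u where S: "finite S" "S \<subseteq> v ` I" "\<exists>x\<in>S. u x \<noteq> 0" "(\<Sum>x\<in>S. scale (u x) x) = 0"
    unfolding dependent_explicit by blast
  then obtain J where J: "J \<subseteq> I" "S = v ` J"
    by (meson subset_imageE)
  with True have "inj_on v J"
    using inj_on_subset by blast
  with S J show ?thesis
    by (intro exI [of _ J] exI [of _ "u \<circ> v"]) (auto simp: finite_image_iff sum.reindex)
next
  case False
  then obtain j k where "j \<in> I" "k \<in> I" "v j = v k" "j \<noteq> k"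
    by (auto simp: inj_on_def)
  then show ?thesis
    by (intro exI [of _ "{j, k}"] exI [of _ "\<lambda>l. if l = j then 1 else - 1"]) auto
qed

lemma ratfun_common_denominator:
  fixes u :: "'i \<Rightarrow> ('a :: field, 'n :: finite) ratfun"
  assumes "finite J"
  shows "\<exists>Q p. Q \<noteq> 0 \<and>
    (\<forall>j\<in>J. to_fract (mfps_of_mpoly Q) * fract_of_ratfun (u j) = to_fract (mfps_of_mpoly (p j)))"
proof -
  have "\<exists>P Q. fract_of_ratfun (u j) = Fract (mfps_of_mpoly P) (mfps_of_mpoly Q) \<and> Q \<noteq> 0" for j
    using fract_of_ratfun [of "u j"] by blast
  then obtain P Q where PQ: "\<And>j. fract_of_ratfun (u j) = Fract (mfps_of_mpoly (P j)) (mfps_of_mpoly (Q j))"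
    "\<And>j. Q j \<noteq> 0"
    by metis
  \<comment> \<open>The remaining denominators complete \<open>Q j\<close> to the full
    product.\<close>
  define p where "p = (\<lambda>j. P j * (\<Prod>k\<in>J - {j}. Q k))"
  have "(\<Prod>k\<in>J. Q k) \<noteq> 0"
    by (rule mpoly_prod_nonzero) (rule PQ(2))
  moreover have "to_fract (mfps_of_mpoly (\<Prod>k\<in>J. Q k)) * fract_of_ratfun (u j) =
      to_fract (mfps_of_mpoly (p j))" if "j \<in> J" for j
    using PQ(2) [of j] assms that
    by (simp add: PQ(1) to_fract_def eq_fract p_def prod.remove [of J j Q])
  ultimately show ?thesis
    by blast
qed

lemma mfps_polynomial_relation:
  fixes v :: "nat \<Rightarrow> ('a :: field, 'n :: finite) mfps"
  assumes "finite B" and "\<And>j. to_fract (v j) \<in> ratfun.span B"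
  obtains q m where "q m \<noteq> 0" and "(\<Sum>j\<le>m. mfps_of_mpoly (q j) * v j) = 0"
proof -
  obtain J u where J: "finite J" "\<exists>j\<in>J. u j \<noteq> 0" "(\<Sum>j\<in>J. ratfun_scale (u j) (to_fract (v j))) = 0"
    using ratfun.infinite_family_dependent [of B "UNIV :: nat set" "\<lambda>j. to_fract (v j)"] assms
    by auto
  obtain Q p where Qp: "Q \<noteq> 0"
    "\<And>j. j \<in> J \<Longrightarrow> to_fract (mfps_of_mpoly Q) * fract_of_ratfun (u j) = to_fract (mfps_of_mpoly (p j))"
    using ratfun_common_denominator [OF J(1), of u] by blast
  define q where "q = (\<lambda>j. if j \<in> J then p j else 0)"
  have fract_sum: "to_fract (sum g A) = (\<Sum>a\<in>A. to_fract (g a))"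
    for g :: "nat \<Rightarrow> ('a, 'n) mfps" and A
    by (induction A rule: infinite_finite_induct) (auto simp: to_fract_add [symmetric])
  have "to_fract (\<Sum>j\<in>J. mfps_of_mpoly (p j) * v j) =
      to_fract (mfps_of_mpoly Q) * (\<Sum>j\<in>J. ratfun_scale (u j) (to_fract (v j)))"
    by (simp add: fract_sum sum_distrib_left ratfun_scale_def Qp(2) [symmetric]
        flip: mult.assoc)
  then have rel: "(\<Sum>j\<in>J. mfps_of_mpoly (p j) * v j) = 0"
    unfolding J(3) by (simp only: mult_zero_right to_fract_eq_0_iff)
  obtain j where j: "j \<in> J" "u j \<noteq> 0"
    using J(2) by blast
  have "fract_of_ratfun (u j) \<noteq> 0"
    using j(2) by (metis fract_of_ratfun_inject zero_ratfun.rep_eq)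
  then have "q j \<noteq> 0"
    using Qp(2) [OF j(1)] Qp(1) j(1) by (auto simp: q_def)
  \<comment> \<open>Cutting at the last nonzero coefficient makes the top one, \<open>q m\<close>,
    nonzero; the dropped terms are zero.\<close>
  define m where "m = Max {j\<in>J. q j \<noteq> 0}"
  have fin: "finite {j\<in>J. q j \<noteq> 0}" and "{j\<in>J. q j \<noteq> 0} \<noteq> {}"
    using J(1) j(1) \<open>q j \<noteq> 0\<close> by auto
  then have "m \<in> {j\<in>J. q j \<noteq> 0}"
    unfolding m_def by (rule Max_in)
  moreover have "k \<le> m" if "k \<in> J" "q k \<noteq> 0" for k
    unfolding m_def by (rule Max_ge) (use fin that in auto)
  moreover have "(\<Sum>j\<le>m. mfps_of_mpoly (q j) * v j) = (\<Sum>j | j \<in> J \<and> q j \<noteq> 0. mfps_of_mpoly (q j) * v j)"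
    by (rule sum.mono_neutral_right) (use calculation in \<open>auto simp: q_def\<close>)
  moreover have "\<dots> = (\<Sum>j\<in>J. mfps_of_mpoly (p j) * v j)"
    by (rule sum.mono_neutral_cong_left) (use J(1) in \<open>auto simp: q_def\<close>)
  ultimately show thesis
    using that rel by auto
qed

lemma D_finite_euler_relation:
  fixes F :: "('a :: field, 'n :: finite) mfps"
  assumes "D_finite F"
  obtains q m where "q m \<noteq> 0" and "(\<Sum>j\<le>m. mfps_of_mpoly (q j) * mfps_euler i j F) = 0"
proof -
  obtain B where B: "finite B"
    "ratfun.span B = ratfun.span (range (\<lambda>k. to_fract (mfps_mixed_deriv k F)))"
    using assms by (auto simp: D_finite_def)
  have "to_fract (mfps_euler i j F) \<in> ratfun.span B" for j
  proof -
    let ?X = "Poly_Mapping.single (axis i j) (1 :: 'a)"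
    have "to_fract (mfps_mixed_deriv (axis i j) F) \<in> ratfun.span B"
      unfolding B(2) by (rule ratfun.span_base) blast
    \<comment> \<open>The monomial x_i^j is a scalar of the vector space, so multiplying by it stays
      in the span.\<close>
    then have "ratfun_scale (Abs_ratfun (to_fract (mfps_of_mpoly ?X)))
        (to_fract (mfps_mixed_deriv (axis i j) F)) \<in> ratfun.span B"
      by (rule ratfun.span_scale)
    moreover have "fract_of_ratfun (Abs_ratfun (to_fract (mfps_of_mpoly ?X))) = to_fract (mfps_of_mpoly ?X)"
      by (rule Abs_ratfun_inverse, intro CollectI exI [of _ 1] exI [of _ ?X]) (simp add: to_fract_def)
    ultimately show ?thesis
      by (simp add: ratfun_scale_def mfps_euler_def mfps_mixed_deriv_axis to_fract_mult)
  qed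
  then show thesis
    using mfps_polynomial_relation [OF B(1), of "\<lambda>j. mfps_euler i j F"] that by blast
qed

subsection \<open>Univariate polynomials with large integer roots\<close>

text \<open>A product of \<open>m\<close> monic linear factors: the shifts change only constant
  terms.\<close>

lemma degree_pochhammer_linear: "degree (pochhammer [:c, 1 :: 'a :: idom:] m) = m"
  and lead_coeff_pochhammer_linear: "lead_coeff (pochhammer [:c, 1 :: 'a :: idom:] m) = 1"
proof -
  have eq: "[:c, 1:] + of_nat l = [:c + of_nat l, 1:]" for l
    by (simp add: of_nat_poly)
  show "degree (pochhammer [:c, 1 :: 'a:] m) = m"
    by (simp add: pochhammer_prod eq degree_prod_eq_sum_degree)
  show "lead_coeff (pochhammer [:c, 1 :: 'a:] m) = 1"
    by (simp add: pochhammer_prod eq lead_coeff_prod)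
qed

lemma poly_pochhammer: "poly (pochhammer p m) x = pochhammer (poly p x) m"
  for p :: "'a :: comm_ring_1 poly"
  by (induction m) (auto simp: pochhammer_Suc of_nat_poly)

text \<open>In characteristic zero \<open>of_nat\<close> is injective, so each nonzero polynomial
  has finitely many natural roots; a finite set of polynomials admits a common bound.\<close>

lemma finite_polys_no_large_nat_root:
  fixes S :: "'a :: field_char_0 poly set"
  assumes "finite S"
  shows "\<exists>N. \<forall>p\<in>S. \<forall>k\<ge>N. poly p (of_nat k) = 0 \<longrightarrow> p = 0"
proof -
  have "finite {k :: nat. poly p (of_nat k) = 0}" if "p \<noteq> 0" for p :: "'a poly"
    using finite_vimageI [OF poly_roots_finite [OF that], of of_nat]
    by (simp add: vimage_def inj_on_def)
  then have "finite (\<Union>p\<in>S - {0}. {k :: nat. poly p (of_nat k) = 0})"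
    using assms by auto
  then obtain N where "\<And>k. k \<in> (\<Union>p\<in>S - {0}. {k :: nat. poly p (of_nat k) = 0}) \<Longrightarrow> k < N"
    by (metis finite_nat_set_iff_bounded)
  then show ?thesis
    by (intro exI [of _ N]) (auto simp: not_less [symmetric])
qed

subsection \<open>Series with bounded support\<close>

definition mfps_bounded_in :: "'n \<Rightarrow> ('a :: zero, 'n :: finite) mfps \<Rightarrow> bool" where
  "mfps_bounded_in i F \<longleftrightarrow> (\<exists>N. \<forall>n. N \<le> n $ i \<longrightarrow> mfps_coeff F n = 0)"

lemma mfps_bounded_in_mult_mpoly:
  fixes P :: "(nat ^ 'n :: finite) \<Rightarrow>\<^sub>0 'a :: comm_ring_1"
  assumes "mfps_bounded_in i F"
  shows "mfps_bounded_in i (mfps_of_mpoly P * F)"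
proof -
  obtain N where N: "\<And>n. N \<le> n $ i \<Longrightarrow> mfps_coeff F n = 0"
    using assms by (auto simp: mfps_bounded_in_def)
  \<comment> \<open>A crude bound on the degree of \<open>P\<close> in direction \<open>i\<close>:
    from \<open>N + M\<close> on, every \<open>n - a\<close> still has entry at least
    \<open>N\<close>.\<close>
  define M where "M = (\<Sum>a\<in>Poly_Mapping.keys P. a $ i)"
  have "a $ i \<le> M" if "a \<in> Poly_Mapping.keys P" for a
    unfolding M_def by (rule member_le_sum) (use that in auto)
  then have "mfps_coeff (mfps_of_mpoly P * F) n = 0" if "N + M \<le> n $ i" for n
    unfolding mfps_coeff_mult_mpoly by (intro sum.neutral ballI) (use that N in fastforce)
  then show ?thesis
    by (auto simp: mfps_bounded_in_def)
qed

lemma mfps_bounded_imp_mpoly: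
  fixes F :: "('a :: comm_ring_1, 'n :: finite) mfps"
  assumes "\<And>i. mfps_bounded_in i F"
  shows "\<exists>P. F = mfps_of_mpoly P"
proof -
  obtain N where N: "\<And>i n. N i \<le> n $ i \<Longrightarrow> mfps_coeff F n = 0"
    using assms unfolding mfps_bounded_in_def by metis
  have "{n. mfps_coeff F n \<noteq> 0} \<subseteq> {n. n \<le> (\<chi> i. N i)}"
    using N by (auto simp: less_eq_vec_def) (meson nat_le_linear)
  then have "finite {n. mfps_coeff F n \<noteq> 0}"
    using finite_vec_le finite_subset by blast
  then show ?thesis
    by (intro exI [of _ "Abs_poly_mapping (mfps_coeff F)"] mfps_ext)
       (simp add: mfps_of_mpoly_def Abs_poly_mapping_inverse)
qed

lemma euler_relation_bounded_in:
  fixes F :: "('a :: field_char_0, 'n :: finite) mfps"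
  assumes "finite \<Delta>" and "\<And>n. mfps_coeff F n \<in> \<Delta>"
    and "(\<Sum>j\<le>m. mfps_of_mpoly (q j) * mfps_euler i j F) = 0"
  shows "mfps_bounded_in i (mfps_of_mpoly (q m) * F)"
proof -
  define A where "A = (\<Union>j\<le>m. Poly_Mapping.keys (q j))"
  \<comment> \<open>\<open>T j a\<close> is the Euler factor at \<open>n - a\<close>, as a
    polynomial in n_i: the falling factorial of n_i - a_i of length \<open>j\<close>.\<close>
  define T :: "nat \<Rightarrow> nat ^ 'n \<Rightarrow> 'a poly"
    where "T = (\<lambda>j a. pochhammer [:1 - of_nat j - of_nat (a $ i), 1:] j)"
  define R where "R = (\<lambda>g. \<Sum>j\<le>m. \<Sum>a\<in>Poly_Mapping.keys (q j).
    smult (Poly_Mapping.lookup (q j) a * g a) (T j a))"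
  \<comment> \<open>The window of coefficients near \<open>n\<close>; positions outside the exponent
    range hold 0, whence \<open>insert 0 \<Delta>\<close> below.\<close>
  define g where "g = (\<lambda>n a. if a \<le> n then mfps_coeff F (n - a) else 0)"
  \<comment> \<open>Restricting to the finite set \<open>A\<close> leaves only finitely many
    windows, hence finitely many polynomials \<open>R (g n)\<close>.\<close>
  have R_restrict: "R (restrict h A) = R h" for h
    unfolding R_def by (intro sum.cong refl) (auto simp: A_def)
  have "finite A"
    by (simp add: A_def)
  then have "finite (R ` (A \<rightarrow>\<^sub>E insert 0 \<Delta>))"
    using assms(1) by (intro finite_imageI finite_PiE) auto
  then obtain N where N: "\<And>p k. p \<in> R ` (A \<rightarrow>\<^sub>E insert 0 \<Delta>) \<Longrightarrow> N \<le> k \<Longrightarrow> poly p (of_nat k) = 0 \<Longrightarrow> p = 0"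
    by (metis finite_polys_no_large_nat_root)
  have R_mem: "R (g n) \<in> R ` (A \<rightarrow>\<^sub>E insert 0 \<Delta>)" for n
  proof
    show "R (g n) = R (restrict (g n) A)"
      by (simp add: R_restrict)
    show "restrict (g n) A \<in> A \<rightarrow>\<^sub>E insert 0 \<Delta>"
      using assms(2) by (auto simp: g_def)
  qed
  have root: "poly (R (g n)) (of_nat (n $ i)) = 0" for n
  proof -
    have coeff: "(if a \<le> n then mfps_coeff (mfps_euler i j F) (n - a) else 0) =
        g n a * poly (T j a) (of_nat (n $ i))" for j a
    proof (cases "a \<le> n")
      case True
      then have "of_nat ((n - a) $ i) - of_nat j + 1 =
          poly [:1 - of_nat j - of_nat (a $ i), 1 :: 'a:] (of_nat (n $ i))"
        by (simp add: less_eq_vec_def of_nat_diff)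
      with True show ?thesis
        by (simp only: g_def T_def mfps_coeff_euler poly_pochhammer if_True mult.commute)
    qed (simp add: g_def)
    have coeff_sum: "mfps_coeff (sum h S) n = (\<Sum>j\<in>S. mfps_coeff (h j) n)"
      for h :: "nat \<Rightarrow> ('a, 'n) mfps" and S
      by (induction S rule: infinite_finite_induct) (auto simp: zero_mfps.rep_eq plus_mfps.rep_eq)
    have "poly (R (g n)) (of_nat (n $ i)) =
        mfps_coeff (\<Sum>j\<le>m. mfps_of_mpoly (q j) * mfps_euler i j F) n"
      by (simp add: R_def poly_sum coeff_sum mfps_coeff_mult_mpoly coeff mult.assoc)
    then show ?thesis
      by (simp add: assms(3) zero_mfps.rep_eq)
  qed
  have coeff_R: "coeff (R (g n)) m = mfps_coeff (mfps_of_mpoly (q m) * F) n" for n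
  proof -
    have deg: "degree (T j a) = j" and lead: "coeff (T j a) j = 1" for j a
      using lead_coeff_pochhammer_linear [where ?'a = 'a]
      by (simp_all add: T_def degree_pochhammer_linear)
    \<comment> \<open>Terms with \<open>j < m\<close> have degree below \<open>m\<close>, so only
      \<open>j = m\<close> contributes.\<close>
    have "coeff (R (g n)) m = (\<Sum>j\<in>{m}. \<Sum>a\<in>Poly_Mapping.keys (q j).
        Poly_Mapping.lookup (q j) a * g n a * coeff (T j a) m)"
      unfolding R_def coeff_sum coeff_smult
      by (rule sum.mono_neutral_right) (auto simp: coeff_eq_0 deg)
    then show ?thesis
      by (simp add: lead mfps_coeff_mult_mpoly g_def)
  qed
  have "mfps_coeff (mfps_of_mpoly (q m) * F) n = 0" if "N \<le> n $ i" for n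
    using N [OF R_mem that root] by (simp flip: coeff_R)
  then show ?thesis
    by (auto simp: mfps_bounded_in_def)
qed

theorem theorem1p3:
  fixes \<Delta> :: "'k :: field_char_0 set"
    and f :: "nat ^ 'n \<Rightarrow> 'k"
  assumes "finite \<Delta>"
    and "\<And>n. f n \<in> \<Delta>"
    and "D_finite (Abs_mfps f)"
  shows "\<exists>P Q :: (nat ^ 'n) \<Rightarrow>\<^sub>0 'k. Q \<noteq> 0 \<and>
    to_fract (Abs_mfps f) = Fract (mfps_of_mpoly P) (mfps_of_mpoly Q)"
proof -
  let ?F = "Abs_mfps f"
  have "\<exists>q. q \<noteq> 0 \<and> mfps_bounded_in i (mfps_of_mpoly q * ?F)" for i
  proof -
    obtain q m where "q m \<noteq> 0" "(\<Sum>j\<le>m. mfps_of_mpoly (q j) * mfps_euler i j ?F) = 0"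
      using D_finite_euler_relation [OF assms(3)] .
    then show ?thesis
      using euler_relation_bounded_in [OF assms(1), of ?F q i m] assms(2) by auto
  qed
  then obtain q where q: "\<And>i. q i \<noteq> 0" "\<And>i. mfps_bounded_in i (mfps_of_mpoly (q i) * ?F)"
    by metis
  define Q where "Q = (\<Prod>i\<in>UNIV. q i)"
  have "Q \<noteq> 0"
    unfolding Q_def by (rule mpoly_prod_nonzero) (rule q(1))
  have "mfps_bounded_in i (mfps_of_mpoly Q * ?F)" for i
  proof -
    \<comment> \<open>Splitting off \<open>q i\<close> leaves a polynomial cofactor, which preserves
      boundedness in direction \<open>i\<close>.\<close>
    have "mfps_of_mpoly Q * ?F = mfps_of_mpoly (\<Prod>k\<in>UNIV - {i}. q k) * (mfps_of_mpoly (q i) * ?F)"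
      by (simp add: Q_def prod.remove [of UNIV i] mult_ac)
    then show ?thesis
      using mfps_bounded_in_mult_mpoly [OF q(2)] by (simp only:)
  qed
  then obtain P where "mfps_of_mpoly Q * ?F = mfps_of_mpoly P"
    using mfps_bounded_imp_mpoly by blast
  then have "to_fract ?F = Fract (mfps_of_mpoly P) (mfps_of_mpoly Q)"
    using \<open>Q \<noteq> 0\<close> by (simp add: to_fract_def eq_fract mult.commute)
  then show ?thesis
    using \<open>Q \<noteq> 0\<close> by auto
qed

end
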